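(* There are no non-trivial special triples. That is: if $(X,G,H)$ is a special triple, then $|X|=1$.
   Context: Consider triples $(X,G,H)$ consisting of a finite set $X$, a finite group $G$ acting transitively on $X$, and a normal subgroup $H\lhd G_x$ of the stabilizer $G_x$ of a distinguished point $x\in X$. Given such a triple and $y\in X$, put $H_y:=gHg^{-1}$, where $g\in G$ is any element with $y=g\cdot x$; this is independent of the choice of $g$ because $H$ is normal in $G_x$. For a subset $Y=\{y_1,\dots,y_m\}\subset X$, denote by $\langle Y\rangle=\langle y_1,\dots,y_m\rangle$ the subgroup of $G$ generated by $\bigcup_{y\in Y}H_y$. A triple is trivial if $|X|=1$. A triple $(X,G,H)$ is special if: (1) $\langle X\rangle$ acts transitively on $X$; and (2) for any two distinct elements $y\neq z$ of $X$, $y$ and $z$ are not in the same $\langle y,z\rangle$-orbit. *)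

theory Defs
  imports "HOL-Algebra.Group_Action" "HOL-Algebra.Generated_Groups"
begin

locale action_triple = transitive_action G X \<phi>
  for G (structure) and X :: "'x set" and \<phi> +
  fixes H and x :: 'x
  assumes finite_X: "finite X"
    and finite_G: "finite (carrier G)"
    and base_point: "x \<in> X"
    and normal_H: "H \<lhd> (G\<lparr>carrier := stabilizer G \<phi> x\<rparr>)"
begin

text \<open>The subgroup \<open>H\<^sub>y = g H g\<^sup>-\<^sup>1\<close> for \<open>y = g \<cdot> x\<close>; independence of the choice of \<open>g\<close> is
  \<open>subgroup_at_eq\<close> below.\<close>

definition subgroup_at :: "'x \<Rightarrow> 'a set" where
  "subgroup_at y = (let g = (SOME g. g \<in> carrier G \<and> \<phi> g x = y) in g <# H #> inv g)"

definition span :: "'x set \<Rightarrow> 'a set" where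
  "span Y = generate G (\<Union>y\<in>Y. subgroup_at y)"

abbreviation span_group :: "'x set \<Rightarrow> ('a, 'b) monoid_scheme" where
  "span_group Y \<equiv> G\<lparr>carrier := span Y\<rparr>"

lemma subgroup_at_eq:
  assumes g: "g \<in> carrier G" and y: "\<phi> g x = y"
  shows "subgroup_at y = g <# H #> inv g"
proof -
  interpret group G
    using group_hom group_hom.axioms(1) by auto
  interpret N: normal H "G\<lparr>carrier := stabilizer G \<phi> x\<rparr>"
    by (rule normal_H)
  have stab: "stabilizer G \<phi> x \<subseteq> carrier G"
    by (auto simp: stabilizer_def)
  have HG: "H \<subseteq> carrier G"
    using N.subset stab by auto
  define g' where "g' = (SOME g. g \<in> carrier G \<and> \<phi> g x = y)"
  have g': "g' \<in> carrier G \<and> \<phi> g' x = y"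
    unfolding g'_def by (rule someI[of _ g]) (use g y in auto)
  define k where "k = inv g \<otimes> g'"
  have kG: "k \<in> carrier G"
    using g g' by (simp add: k_def)
  have "\<phi> k x = \<phi> (inv g) (\<phi> g' x)"
    unfolding k_def using g g' base_point by (intro composition_rule) auto
  also have "\<dots> = x"
    using orbit_sym_aux[OF g base_point y] g' by simp
  finally have kS: "k \<in> stabilizer G \<phi> x"
    using kG by (simp add: stabilizer_def)
  have g'k: "g' = g \<otimes> k"
    using g g' by (simp add: k_def m_assoc[symmetric])
  have kH: "k <# H = H #> k"
    using N.coset_eq kS by (simp add: l_coset_def r_coset_def)
  have "g' <# H #> inv g' = g <# (k <# H) #> inv g'"
    using g kG HG by (simp add: g'k lcos_m_assoc)
  also have "\<dots> = g <# (H #> k) #> inv g'"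
    by (simp add: kH)
  also have "\<dots> = g <# H #> k #> inv g'"
    using g kG HG by (simp add: coset_assoc)
  also have "\<dots> = g <# H #> (k \<otimes> inv g')"
    using g g' kG HG by (intro coset_mult_assoc) (auto simp: l_coset_subset_G)
  also have "k \<otimes> inv g' = inv g"
    using g kG by (simp add: g'k inv_mult_group m_assoc[symmetric])
  finally show ?thesis
    by (simp add: subgroup_at_def g'_def[symmetric])
qed

end

locale special_triple = action_triple +
  assumes span_transitive: "transitive_action (span_group X) X \<phi>"
    and separated: "\<lbrakk>y \<in> X; z \<in> X; y \<noteq> z\<rbrakk> \<Longrightarrow> z \<notin> orbit (span_group {y, z}) \<phi> y"

end

theory Submission
  imports Defs
begin

text \<open>Write \<open>N = \<langle>X\<rangle>\<close> and \<open>H\<^sup>g = g H g\<^sup>-\<^sup>1\<close>. The action enters only through two observations. Separation says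
  that an element \<open>g\<close> lying in \<open>\<langle>H, H\<^sup>g\<rangle> = \<langle>x, g \<cdot> x\<rangle>\<close> fixes \<open>x\<close>, and hence normalizes \<open>H\<close>.
  Transitivity of \<open>N\<close> says that the groups \<open>H\<^sub>y\<close> are the \<open>N\<close>-conjugates of \<open>H\<close>, so that \<open>N\<close> is the
  normal closure of \<open>H\<close> in itself. If \<open>H\<close> is subnormal in \<open>N\<close>, then \<open>H = N\<close>, since otherwise the
  normal closure of \<open>H\<close> would be proper; thus \<open>N\<close> fixes \<open>x\<close> and is transitive, and \<open>X = {x}\<close>.

  So everything rests on a subnormality criterion: if every \<open>g\<close> in \<open>\<langle>H, H\<^sup>g\<rangle>\<close> normalizes \<open>H\<close>, then
  \<open>H\<close> is subnormal (\<open>subnormal_if_conjugators_in_join_normalize\<close>). By Wielandt's theorem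
  (\<open>Wielandt_subnormal\<close>) it suffices that \<open>H\<close> be subnormal in each \<open>\<langle>H, H\<^sup>g\<rangle>\<close>. If this group is
  proper, induction on the order applies, because the hypothesis passes to subgroups; if it is the
  whole group, it contains \<open>g\<close>, so \<open>H\<^sup>g = H\<close> and the whole group is \<open>H\<close>.

  Wielandt's theorem follows from his zipper lemma (\<open>largest_proper_overgroup\<close>): if \<open>H\<close> is
  subnormal in every proper subgroup above it but not in the whole group, then there is a largest
  proper subgroup \<open>M\<close> above \<open>H\<close>. In a minimal counterexample to the theorem all \<open>\<langle>H, H\<^sup>g\<rangle>\<close> are
  proper, hence inside \<open>M\<close>, hence the normal closure of \<open>H\<close> is inside \<open>M\<close> too; \<open>H\<close> is subnormal
  in it, and it is normal in the whole group, a contradiction.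

  The zipper lemma needs that the join of two subnormal subgroups, one of which normalizes the
  other, is subnormal (\<open>subnormal_join\<close>).\<close>

section \<open>Conjugate subsets and generated subgroups\<close>

definition conjugate :: "('a, 'b) monoid_scheme \<Rightarrow> 'a \<Rightarrow> 'a set \<Rightarrow> 'a set" where
  "conjugate G g A = (\<lambda>a. g \<otimes>\<^bsub>G\<^esub> a \<otimes>\<^bsub>G\<^esub> inv\<^bsub>G\<^esub> g) ` A"

context group
begin

lemma conjugate_eq_cosets: "conjugate G g A = g <# A #> inv g"
  by (auto simp: conjugate_def l_coset_def r_coset_def)

lemma conjugate_subset_carrier:
  "g \<in> carrier G \<Longrightarrow> A \<subseteq> carrier G \<Longrightarrow> conjugate G g A \<subseteq> carrier G"
  by (auto simp: conjugate_def)

lemma conjugate_one: "A \<subseteq> carrier G \<Longrightarrow> conjugate G \<one> A = A"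
  by (force simp: conjugate_def)

lemma conjugate_mult:
  assumes "g \<in> carrier G" "h \<in> carrier G" "A \<subseteq> carrier G"
  shows "conjugate G (g \<otimes> h) A = conjugate G g (conjugate G h A)"
  unfolding conjugate_def image_image
  by (rule image_cong) (use assms in \<open>auto simp: m_assoc inv_mult_group subset_iff\<close>)

lemma conjugate_inv_conjugate:
  assumes "g \<in> carrier G" "A \<subseteq> carrier G"
  shows "conjugate G (inv g) (conjugate G g A) = A"
    and "conjugate G g (conjugate G (inv g) A) = A"
  using assms conjugate_mult[of "inv g" g A] conjugate_mult[of g "inv g" A]
  by (simp_all add: conjugate_one)

lemma conjugate_mono: "A \<subseteq> B \<Longrightarrow> conjugate G g A \<subseteq> conjugate G g B"
  by (auto simp: conjugate_def)

lemma subgroup_conjugate: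
  assumes g: "g \<in> carrier G" and A: "subgroup A G"
  shows "subgroup (conjugate G g A) G"
proof -
  note AG = subgroup.mem_carrier[OF A]
  show ?thesis
  proof
    show "conjugate G g A \<subseteq> carrier G"
      using g subgroup.subset[OF A] by (rule conjugate_subset_carrier)
  next
    fix u v assume "u \<in> conjugate G g A" "v \<in> conjugate G g A"
    then obtain a b where ab: "a \<in> A" "b \<in> A" "u = g \<otimes> a \<otimes> inv g" "v = g \<otimes> b \<otimes> inv g"
      by (auto simp: conjugate_def)
    have "inv g \<otimes> (g \<otimes> (b \<otimes> inv g)) = b \<otimes> inv g"
      using g AG ab(2) by (simp add: m_assoc[symmetric])
    then have "u \<otimes> v = g \<otimes> (a \<otimes> b) \<otimes> inv g"
      unfolding ab using g AG ab(1,2) by (simp add: m_assoc)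
    then show "u \<otimes> v \<in> conjugate G g A"
      using subgroup.m_closed[OF A ab(1,2)] by (auto simp: conjugate_def)
  next
    have "\<one> = g \<otimes> \<one> \<otimes> inv g" using g by simp
    then show "\<one> \<in> conjugate G g A"
      unfolding conjugate_def using subgroup.one_closed[OF A] by blast
  next
    fix u assume "u \<in> conjugate G g A"
    then obtain a where a: "a \<in> A" "u = g \<otimes> a \<otimes> inv g"
      by (auto simp: conjugate_def)
    have "inv u = g \<otimes> inv a \<otimes> inv g"
      unfolding a using g AG a(1) by (simp add: inv_mult_group m_assoc)
    then show "inv u \<in> conjugate G g A"
      using subgroup.m_inv_closed[OF A a(1)] by (auto simp: conjugate_def)
  qed
qed

lemma conjugate_subset_subgroup:
  assumes "subgroup K G" "g \<in> K" "A \<subseteq> K"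
  shows "conjugate G g A \<subseteq> K"
  using assms by (auto simp: conjugate_def subset_iff subgroup.m_closed subgroup.m_inv_closed)

lemma conjugate_self:
  assumes "subgroup K G" "g \<in> K"
  shows "conjugate G g K = K"
proof
  show "conjugate G g K \<subseteq> K" using assms by (simp add: conjugate_subset_subgroup)
  have "conjugate G g (conjugate G (inv g) K) \<subseteq> conjugate G g K"
    using assms by (intro conjugate_mono conjugate_subset_subgroup subgroup.m_inv_closed) auto
  then show "K \<subseteq> conjugate G g K"
    using assms conjugate_inv_conjugate(2)[of g K]
    by (simp add: subgroup.mem_carrier subgroup.subset)
qed

lemma conjugate_generate_subset:
  assumes g: "g \<in> carrier G" and A: "A \<subseteq> carrier G" and B: "subgroup B G"
    and AB: "conjugate G g A \<subseteq> B"
  shows "conjugate G g (generate G A) \<subseteq> B"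
proof -
  have "subgroup (conjugate G (inv g) B) G"
    using g B by (simp add: subgroup_conjugate)
  moreover have "A \<subseteq> conjugate G (inv g) B"
    using conjugate_mono[OF AB, of "inv g"] conjugate_inv_conjugate(1)[OF g A] by simp
  ultimately have "generate G A \<subseteq> conjugate G (inv g) B"
    by (intro generate_subgroup_incl)
  then show ?thesis
    using conjugate_mono[of "generate G A" "conjugate G (inv g) B" g]
      conjugate_inv_conjugate(2)[OF g subgroup.subset[OF B]] by simp
qed

lemma subgroup_normalizing:
  assumes K: "subgroup K G" and A: "A \<subseteq> carrier G"
  shows "subgroup {g \<in> K. conjugate G g A = A} G"
proof
  show "{g \<in> K. conjugate G g A = A} \<subseteq> carrier G"
    using subgroup.subset[OF K] by auto
next
  fix g h assume "g \<in> {g \<in> K. conjugate G g A = A}" "h \<in> {g \<in> K. conjugate G g A = A}"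
  then show "g \<otimes> h \<in> {g \<in> K. conjugate G g A = A}"
    using conjugate_mult[of g h A] A
    by (simp add: subgroup.m_closed[OF K] subgroup.mem_carrier[OF K])
next
  show "\<one> \<in> {g \<in> K. conjugate G g A = A}"
    using A by (simp add: conjugate_one subgroup.one_closed[OF K])
next
  fix g assume "g \<in> {g \<in> K. conjugate G g A = A}"
  then show "inv g \<in> {g \<in> K. conjugate G g A = A}"
    using conjugate_inv_conjugate(1)[of g A] A
    by (simp add: subgroup.m_inv_closed[OF K] subgroup.mem_carrier[OF K])
qed

end

section \<open>Relative normality\<close>

context group
begin

lemma normal_in_subgroup_iff:
  assumes L: "subgroup L G"
  shows "K \<lhd> (G\<lparr>carrier := L\<rparr>) \<longleftrightarrow>
    subgroup K G \<and> K \<subseteq> L \<and> (\<forall>g\<in>L. conjugate G g K = K)"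
proof -
  interpret L: group "G\<lparr>carrier := L\<rparr>"
    using L by (rule subgroup_imp_group)
  have sub: "subgroup K (G\<lparr>carrier := L\<rparr>) \<longleftrightarrow> subgroup K G \<and> K \<subseteq> L"
    using incl_subgroup[OF L] subgroup_incl[OF _ L] subgroup.subset[of K "G\<lparr>carrier := L\<rparr>"]
    by auto
  have "(\<forall>g\<in>L. conjugate G g K = K) \<longleftrightarrow> (\<forall>g\<in>L. conjugate G g K \<subseteq> K)" if K: "subgroup K G"
  proof (intro iffI ballI)
    fix g assume *: "\<forall>g\<in>L. conjugate G g K \<subseteq> K" and g: "g \<in> L"
    have "conjugate G g (conjugate G (inv g) K) \<subseteq> conjugate G g K"
      using * g L by (intro conjugate_mono) (simp add: subgroup.m_inv_closed)
    then have "K \<subseteq> conjugate G g K"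
      using conjugate_inv_conjugate(2) g L K by (simp add: subgroup.mem_carrier subgroup.subset)
    then show "conjugate G g K = K" using * g by blast
  qed auto
  moreover have "(\<forall>g\<in>L. conjugate G g K \<subseteq> K) \<longleftrightarrow>
    (\<forall>g\<in>L. \<forall>k\<in>K. g \<otimes> k \<otimes> inv\<^bsub>G\<lparr>carrier := L\<rparr>\<^esub> g \<in> K)"
    using L by (auto simp: conjugate_def m_inv_consistent)
  ultimately show ?thesis
    unfolding L.normal_inv_iff sub by auto
qed

text \<open>Normality in a generated subgroup can be tested on generators; the generating set being a
  union of subgroups, no separate condition on inverses is needed.\<close>

lemma normal_in_generateI:
  assumes A: "subgroup A G" and B: "subgroup B G" and K: "subgroup K G"
    and sub: "K \<subseteq> generate G (A \<union> B)"
    and nA: "\<And>g. g \<in> A \<Longrightarrow> conjugate G g K \<subseteq> K"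
    and nB: "\<And>g. g \<in> B \<Longrightarrow> conjugate G g K \<subseteq> K"
  shows "K \<lhd> (G\<lparr>carrier := generate G (A \<union> B)\<rparr>)"
proof -
  let ?N = "{g \<in> carrier G. conjugate G g K = K}"
  have KG: "K \<subseteq> carrier G" using K by (rule subgroup.subset)
  have AB: "A \<union> B \<subseteq> carrier G" using A B by (auto dest: subgroup.subset)
  have "A \<union> B \<subseteq> ?N"
  proof
    fix g assume g: "g \<in> A \<union> B"
    then have gG: "g \<in> carrier G" using AB by auto
    have "inv g \<in> A \<union> B" using g A B by (auto simp: subgroup.m_inv_closed)
    then have "conjugate G g (conjugate G (inv g) K) \<subseteq> conjugate G g K"
      using nA nB by (intro conjugate_mono) auto
    then have "K \<subseteq> conjugate G g K"
      using conjugate_inv_conjugate(2)[OF gG KG] by simp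
    moreover have "conjugate G g K \<subseteq> K"
      using g nA nB by blast
    ultimately show "g \<in> ?N"
      using gG by simp
  qed
  then have "generate G (A \<union> B) \<subseteq> ?N"
    by (intro generate_subgroup_incl subgroup_normalizing subgroup_self KG)
  then show ?thesis
    using K sub by (auto simp: normal_in_subgroup_iff[OF generate_is_subgroup[OF AB]])
qed

end

section \<open>Normal closures\<close>

definition normal_closure :: "('a, 'b) monoid_scheme \<Rightarrow> 'a set \<Rightarrow> 'a set \<Rightarrow> 'a set" where
  "normal_closure G K S = generate G (\<Union>k\<in>K. conjugate G k S)"

context group
begin

lemma conjugates_subset:
  assumes "subgroup K G" "S \<subseteq> K"
  shows "(\<Union>k\<in>K. conjugate G k S) \<subseteq> K"
  using conjugate_subset_subgroup[OF assms(1) _ assms(2)] by blast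

lemma subgroup_normal_closure:
  assumes "subgroup K G" "S \<subseteq> K"
  shows "subgroup (normal_closure G K S) G"
  unfolding normal_closure_def
  using conjugates_subset[OF assms] subgroup.subset[OF assms(1)]
  by (intro generate_is_subgroup) auto

lemma normal_closure_subset:
  assumes "subgroup K G" "S \<subseteq> K"
  shows "normal_closure G K S \<subseteq> K"
  unfolding normal_closure_def
  using conjugates_subset[OF assms] assms(1) by (rule generate_subgroup_incl)

lemma subset_normal_closure:
  assumes K: "subgroup K G" and S: "S \<subseteq> K"
  shows "S \<subseteq> normal_closure G K S"
proof -
  have "conjugate G \<one> S = S" using S subgroup.subset[OF K] by (intro conjugate_one) auto
  then have "S \<subseteq> (\<Union>k\<in>K. conjugate G k S)" using subgroup.one_closed[OF K] by blast
  then show ?thesis unfolding normal_closure_def by (auto intro: generate.incl)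
qed

text \<open>The hypothesis \<open>perm\<close> holds both for members \<open>g\<close> of \<open>K\<close>, with \<open>k' = g k\<close>, and for elements that
  normalize \<open>K\<close> and \<open>S\<close>, with \<open>k' = g k g\<^sup>-\<^sup>1\<close>.\<close>

lemma conjugate_normal_closure_subset:
  assumes K: "subgroup K G" and S: "S \<subseteq> K" and g: "g \<in> carrier G"
    and perm: "\<And>k. k \<in> K \<Longrightarrow> \<exists>k'\<in>K. conjugate G (g \<otimes> k) S = conjugate G k' S"
  shows "conjugate G g (normal_closure G K S) \<subseteq> normal_closure G K S"
proof -
  let ?E = "\<Union>k\<in>K. conjugate G k S"
  have KG: "K \<subseteq> carrier G" using K by (rule subgroup.subset)
  have "conjugate G g (conjugate G k S) \<subseteq> ?E" if k: "k \<in> K" for k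
    using perm[OF k] conjugate_mult[of g k S] g k S KG by auto
  moreover have "conjugate G g ?E = (\<Union>k\<in>K. conjugate G g (conjugate G k S))"
    by (simp add: conjugate_def image_UN)
  ultimately have "conjugate G g ?E \<subseteq> ?E" by auto
  then have "conjugate G g ?E \<subseteq> normal_closure G K S"
    unfolding normal_closure_def by (auto intro: generate.incl)
  moreover have "?E \<subseteq> carrier G" using conjugates_subset[OF K S] KG by auto
  ultimately show ?thesis
    using conjugate_generate_subset[OF g _ subgroup_normal_closure[OF K S]]
    by (simp add: normal_closure_def)
qed

lemma conjugate_normal_closure_member:
  assumes K: "subgroup K G" and S: "S \<subseteq> K" and g: "g \<in> K"
  shows "conjugate G g (normal_closure G K S) \<subseteq> normal_closure G K S"
  using assms
  by (intro conjugate_normal_closure_subset) (auto simp: subgroup.mem_carrier subgroup.m_closed)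

lemma conjugate_normal_closure_normalizing:
  assumes K: "subgroup K G" and S: "S \<subseteq> K" and u: "u \<in> carrier G"
    and uK: "conjugate G u K = K" and uS: "conjugate G u S = S"
  shows "conjugate G u (normal_closure G K S) \<subseteq> normal_closure G K S"
proof (rule conjugate_normal_closure_subset[OF K S u])
  fix k assume k: "k \<in> K"
  let ?k = "u \<otimes> k \<otimes> inv u"
  have G: "k \<in> carrier G" "S \<subseteq> carrier G" using k K S by (auto dest: subgroup.subset)
  have k': "?k \<in> K" using uK k by (force simp: conjugate_def)
  have "u \<otimes> k = ?k \<otimes> u" using G u by (simp add: m_assoc)
  then have "conjugate G (u \<otimes> k) S = conjugate G ?k S"
    using conjugate_mult[of ?k u S] G u uS by simp
  then show "\<exists>k'\<in>K. conjugate G (u \<otimes> k) S = conjugate G k' S" using k' by blast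
qed

lemma normal_closure_normal:
  assumes K: "subgroup K G" and S: "S \<subseteq> K"
  shows "normal_closure G K S \<lhd> (G\<lparr>carrier := K\<rparr>)"
proof -
  have "generate G (K \<union> K) = K" using generateI[OF K] by simp
  then show ?thesis
    using normal_in_generateI[OF K K subgroup_normal_closure[OF K S]]
      normal_closure_subset[OF K S] conjugate_normal_closure_member[OF K S] by simp
qed

lemma normal_closure_minimal:
  assumes K: "subgroup K G" and M: "M \<lhd> (G\<lparr>carrier := K\<rparr>)" and S: "S \<subseteq> M"
  shows "normal_closure G K S \<subseteq> M"
proof -
  have M': "subgroup M G" "\<And>g. g \<in> K \<Longrightarrow> conjugate G g M = M"
    using M by (auto simp: normal_in_subgroup_iff[OF K])
  then have "(\<Union>k\<in>K. conjugate G k S) \<subseteq> M" using conjugate_mono[OF S] by blast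
  then show ?thesis unfolding normal_closure_def using M'(1) by (rule generate_subgroup_incl)
qed

end

section \<open>Subnormal subgroups\<close>

inductive subnormal :: "('a, 'b) monoid_scheme \<Rightarrow> 'a set \<Rightarrow> 'a set \<Rightarrow> bool"
  for G and S where
  self: "subgroup S G \<Longrightarrow> subnormal G S S"
| step: "subnormal G S K \<Longrightarrow> subgroup L G \<Longrightarrow> K \<lhd> (G\<lparr>carrier := L\<rparr>) \<Longrightarrow> subnormal G S L"

context group
begin

lemma subnormal_imp_subgroup:
  assumes "subnormal G S L"
  shows "subgroup S G" "subgroup L G" "S \<subseteq> L"
  using assms by (induction) (auto simp: normal_in_subgroup_iff)

lemma subnormal_normal:
  assumes "subgroup L G" "S \<lhd> (G\<lparr>carrier := L\<rparr>)"
  shows "subnormal G S L"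
proof -
  have "subgroup S G" using assms by (simp add: normal_in_subgroup_iff)
  then have "subnormal G S S" by (rule subnormal.self)
  then show ?thesis using assms by (rule subnormal.step)
qed

lemma subnormal_trans:
  assumes "subnormal G K L" "subnormal G S K"
  shows "subnormal G S L"
  using assms
proof (induction)
  case (step M L)
  from step.IH[OF step.prems] step.hyps(2,3) show ?case by (rule subnormal.step)
qed

lemma subnormal_Int:
  assumes "subnormal G S L" "subgroup M G"
  shows "subnormal G (S \<inter> M) (L \<inter> M)"
  using assms
proof (induction)
  case self
  then show ?case by (simp add: subnormal.self subgroups_Inter_pair)
next
  case (step K L)
  have LM: "subgroup (L \<inter> M) G" using step by (simp add: subgroups_Inter_pair)
  have "conjugate G g (K \<inter> M) = K \<inter> M" if g: "g \<in> L \<inter> M" for g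
  proof -
    have "inj_on (\<lambda>a. g \<otimes> a \<otimes> inv g) (carrier G)"
      using g step.hyps(2) by (intro inj_onI) (simp add: subgroup.mem_carrier)
    then have "conjugate G g (K \<inter> M) = conjugate G g K \<inter> conjugate G g M"
      unfolding conjugate_def using step
      by (intro inj_on_image_Int[where C = "carrier G"])
        (auto simp: normal_in_subgroup_iff dest: subgroup.subset)
    then show ?thesis
      using g step by (simp add: normal_in_subgroup_iff conjugate_self)
  qed
  then have "K \<inter> M \<lhd> (G\<lparr>carrier := L \<inter> M\<rparr>)"
    using step by (auto simp: normal_in_subgroup_iff[OF LM] normal_in_subgroup_iff subgroups_Inter_pair)
  with step.IH[OF step.prems] LM show ?case
    by (rule subnormal.step)
qed

lemma subnormal_restrict:
  assumes "subnormal G S L" "subgroup M G" "S \<subseteq> M" "M \<subseteq> L"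
  shows "subnormal G S M"
  using subnormal_Int[OF assms(1,2)] assms(3,4) by (simp add: Int_absorb1 Int_absorb2)

lemma subnormal_conjugate:
  assumes "subnormal G S L" and g: "g \<in> carrier G"
  shows "subnormal G (conjugate G g S) (conjugate G g L)"
  using assms(1)
proof (induction)
  case self
  then show ?case by (simp add: g subnormal.self subgroup_conjugate)
next
  case (step K L)
  have gL: "subgroup (conjugate G g L) G" using step g by (simp add: subgroup_conjugate)
  have K: "subgroup K G" "K \<subseteq> L" "\<And>l. l \<in> L \<Longrightarrow> conjugate G l K = K"
    using step by (auto simp: normal_in_subgroup_iff)
  have KG: "K \<subseteq> carrier G" using K by (auto dest: subgroup.subset)
  have "conjugate G h (conjugate G g K) = conjugate G g K" if h: "h \<in> conjugate G g L" for h
  proof -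
    obtain l where l: "l \<in> L" "h = g \<otimes> l \<otimes> inv g"
      using h by (auto simp: conjugate_def)
    have lG: "l \<in> carrier G" using l step by (simp add: subgroup.mem_carrier)
    have hG: "h \<in> carrier G" using l lG g by simp
    have "h \<otimes> g = g \<otimes> l" using l lG g by (simp add: m_assoc)
    then have "conjugate G h (conjugate G g K) = conjugate G g (conjugate G l K)"
      using conjugate_mult[OF hG g KG] conjugate_mult[OF g lG KG] by simp
    then show ?thesis using K l by simp
  qed
  then have "conjugate G g K \<lhd> (G\<lparr>carrier := conjugate G g L\<rparr>)"
    using K g by (simp add: normal_in_subgroup_iff[OF gL] subgroup_conjugate conjugate_mono)
  with step.IH gL show ?case
    by (rule subnormal.step)
qed

lemma subnormal_imp_normal_closure_proper:
  assumes "subnormal G S L" "S \<noteq> L"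
  shows "normal_closure G L S \<subset> L"
  using assms
proof (induction)
  case (step K L)
  have K: "S \<subseteq> K" "K \<subseteq> L"
    using subnormal_imp_subgroup[OF step.hyps(1)] step.hyps by (auto simp: normal_in_subgroup_iff)
  show ?case
  proof (cases "K = L")
    case True
    then show ?thesis using step by blast
  next
    case False
    then show ?thesis using normal_closure_minimal[OF step.hyps(2,3) K(1)] K by auto
  qed
qed simp

text \<open>Climbing a chain from \<open>S\<close> to \<open>L\<close>, take the first member \<open>B\<close> in which \<open>S\<close> is not normal. Its
  predecessor \<open>A\<close> then contains the conjugates of \<open>S\<close> under \<open>B\<close>, and all of them are normal in
  \<open>A\<close>; so they normalize each other.\<close>

lemma subnormal_not_normal:
  assumes "subnormal G S L" "\<not> S \<lhd> (G\<lparr>carrier := L\<rparr>)"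
  obtains A B where "subgroup A G" "subgroup B G" "B \<subseteq> L"
    "S \<lhd> (G\<lparr>carrier := A\<rparr>)" "A \<lhd> (G\<lparr>carrier := B\<rparr>)" "\<not> S \<lhd> (G\<lparr>carrier := B\<rparr>)"
  using assms
proof (induction arbitrary: thesis)
  case self
  then show ?case by (simp add: normal_in_subgroup_iff conjugate_self)
next
  case (step K L)
  have K: "subgroup K G" "K \<subseteq> L" using step by (auto simp: normal_in_subgroup_iff)
  show ?case
  proof (cases "S \<lhd> (G\<lparr>carrier := K\<rparr>)")
    case True
    then show ?thesis using step K by blast
  next
    case False
    show ?thesis
      by (rule step.IH) (use step.prems False K in blast)+
  qed
qed

end

section \<open>Joins of subnormal subgroups\<close>

context group
begin

text \<open>Joining a normal subgroup \<open>C\<close> to each member of a chain from \<open>U\<close> to \<open>L\<close> preserves the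
  normality of consecutive members, and the chain still ends at \<open>L\<close>.\<close>

lemma subnormal_join_normal:
  assumes "subnormal G U L" and C: "C \<lhd> (G\<lparr>carrier := L\<rparr>)"
  shows "subnormal G (generate G (C \<union> U)) L"
proof -
  have L: "subgroup L G" and UL: "U \<subseteq> L"
    using subnormal_imp_subgroup[OF assms(1)] by auto
  have C': "subgroup C G" "C \<subseteq> L" "\<And>g. g \<in> L \<Longrightarrow> conjugate G g C = C"
    using C L by (auto simp: normal_in_subgroup_iff)
  have CG: "C \<subseteq> carrier G" using C' by (auto dest: subgroup.subset)
  have "M \<subseteq> L \<Longrightarrow> subnormal G (generate G (C \<union> U)) (generate G (C \<union> M))"
    if "subnormal G U M" for M
    using that
  proof (induction)
    case self
    then show ?case using CG
      by (intro subnormal.self generate_is_subgroup) (auto dest: subgroup.subset)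
  next
    case (step K M)
    have K: "subgroup K G" "K \<subseteq> M" "\<And>g. g \<in> M \<Longrightarrow> conjugate G g K = K"
      using step by (auto simp: normal_in_subgroup_iff)
    have CK: "C \<union> K \<subseteq> carrier G" using CG K by (auto dest: subgroup.subset)
    have CM: "C \<union> M \<subseteq> carrier G" using CG step by (auto dest: subgroup.subset)
    have gCK: "subgroup (generate G (C \<union> K)) G" using CK by (rule generate_is_subgroup)
    have incl: "C \<subseteq> generate G (C \<union> K)" "K \<subseteq> generate G (C \<union> K)"
      by (auto intro: generate.incl)
    have "generate G (C \<union> K) \<lhd> (G\<lparr>carrier := generate G (C \<union> M)\<rparr>)"
    proof (rule normal_in_generateI[OF C'(1) step.hyps(2) gCK])
      show "generate G (C \<union> K) \<subseteq> generate G (C \<union> M)"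
        using K by (intro mono_generate) auto
    next
      fix g assume "g \<in> C"
      then show "conjugate G g (generate G (C \<union> K)) \<subseteq> generate G (C \<union> K)"
        using incl conjugate_self[OF gCK] by blast
    next
      fix g assume g: "g \<in> M"
      have "conjugate G g (C \<union> K) = C \<union> K"
        using C'(3)[of g] K(3)[of g] g step.prems by (auto simp: conjugate_def image_Un)
      then show "conjugate G g (generate G (C \<union> K)) \<subseteq> generate G (C \<union> K)"
        using incl g CM by (intro conjugate_generate_subset CK gCK) auto
    qed
    moreover have "subnormal G (generate G (C \<union> U)) (generate G (C \<union> K))"
      using step.prems K by (intro step.IH) auto
    ultimately show ?case
      using generate_is_subgroup[OF CM] subnormal.step by blast
  qed
  moreover have "generate G (C \<union> L) = L"
    using L C'(2) by (simp add: Un_absorb1 generateI[symmetric])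
  ultimately show ?thesis using assms(1) by fastforce
qed

text \<open>A chain from \<open>S\<close> up to \<open>K\<close> need not consist of subgroups normalized by \<open>U\<close>, so one cannot
  simply join \<open>U\<close> to its members. The normal closure \<open>C\<close> of \<open>S\<close> in \<open>K\<close>, however, is normalized by
  \<open>U\<close> because \<open>S\<close> and \<open>K\<close> are, and it is smaller than \<open>K\<close> unless \<open>S = K\<close>. By induction on
  \<open>card K\<close>, the group \<open>\<langle>S, U\<rangle>\<close> is subnormal in \<open>\<langle>C, U\<rangle>\<close>, which is subnormal in \<open>\<langle>K, U\<rangle>\<close> because \<open>C\<close>
  is normal there. Even if \<open>U\<close> starts inside \<open>K\<close>, it need not lie in \<open>C\<close>: this is why the
  statement is about \<open>\<langle>K, U\<rangle>\<close> and not about a \<open>K\<close> containing \<open>U\<close>.\<close>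

lemma subnormal_join_in_normalized:
  assumes fin: "finite K" and SK: "subnormal G S K"
    and US: "\<And>u. u \<in> U \<Longrightarrow> conjugate G u S = S"
    and UK: "\<And>u. u \<in> U \<Longrightarrow> conjugate G u K = K"
    and snU: "subnormal G U (generate G (K \<union> U))"
  shows "subnormal G (generate G (S \<union> U)) (generate G (K \<union> U))"
  using assms
proof (induction K rule: measure_induct_rule[where f = card])
  case (less K)
  note S = subnormal_imp_subgroup[OF less.prems(2)]
  have U: "subgroup U G" using subnormal_imp_subgroup less.prems(5) by blast
  have G: "S \<subseteq> carrier G" "K \<subseteq> carrier G" "U \<subseteq> carrier G"
    using S U by (auto dest: subgroup.subset)
  have KU: "subgroup (generate G (K \<union> U)) G"
    using G by (intro generate_is_subgroup) auto
  show ?case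
  proof (cases "S = K")
    case True
    then show ?thesis using KU by (simp add: subnormal.self)
  next
    case False
    define C where "C = normal_closure G K S"
    have C: "subgroup C G" and CK: "C \<subseteq> K" and SC: "S \<subseteq> C"
      unfolding C_def
      using S(2,3) by (simp_all only: subgroup_normal_closure normal_closure_subset subset_normal_closure)
    have nC: "C \<lhd> (G\<lparr>carrier := generate G (K \<union> U)\<rparr>)"
    proof (rule normal_in_generateI[OF S(2) U C])
      show "C \<subseteq> generate G (K \<union> U)" using CK by (auto intro: generate.incl)
      show "conjugate G g C \<subseteq> C" if "g \<in> K" for g
        unfolding C_def using S that by (intro conjugate_normal_closure_member)
      show "conjugate G u C \<subseteq> C" if "u \<in> U" for u
        unfolding C_def using S G less.prems(3,4) that
        by (intro conjugate_normal_closure_normalizing) auto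
    qed
    have card: "card C < card K"
      unfolding C_def
      using less.prems(1) subnormal_imp_normal_closure_proper[OF less.prems(2) False]
      by (rule psubset_card_mono)
    have CU: "generate G (C \<union> U) \<subseteq> generate G (K \<union> U)"
      using CK by (intro mono_generate) auto
    have sCU: "subgroup (generate G (C \<union> U)) G"
      using CK G by (intro generate_is_subgroup) auto
    have "subnormal G (generate G (S \<union> U)) (generate G (C \<union> U))"
    proof (rule less.IH[OF card])
      show "finite C" using CK less.prems(1) by (rule finite_subset)
      show "subnormal G S C"
        using less.prems(2) C SC CK by (rule subnormal_restrict)
      show "conjugate G u S = S" if "u \<in> U" for u using less.prems(3) that .
      show "conjugate G u C = C" if "u \<in> U" for u
      proof -
        have "U \<subseteq> generate G (K \<union> U)" by (auto intro: generate.incl)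
        then show ?thesis using nC that by (auto simp: normal_in_subgroup_iff[OF KU])
      qed
      show "subnormal G U (generate G (C \<union> U))"
        by (rule subnormal_restrict[OF less.prems(5) sCU _ CU]) (auto intro: generate.incl)
    qed
    with subnormal_join_normal[OF less.prems(5) nC] show ?thesis
      by (rule subnormal_trans)
  qed
qed

lemma subnormal_join:
  assumes "finite L" "subnormal G S L" "subnormal G U L"
    and US: "\<And>u. u \<in> U \<Longrightarrow> conjugate G u S = S"
  shows "subnormal G (generate G (S \<union> U)) L"
proof -
  note L = subnormal_imp_subgroup[OF assms(3)]
  have eq: "generate G (L \<union> U) = L"
    using L by (simp add: Un_absorb2 generateI[symmetric])
  have "subnormal G (generate G (S \<union> U)) (generate G (L \<union> U))"
    using assms L
    by (intro subnormal_join_in_normalized) (auto simp: eq intro!: conjugate_self)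
  then show ?thesis by (simp add: eq)
qed

end

section \<open>Wielandt's subnormality criterion\<close>

context group
begin

text \<open>Wielandt's zipper lemma, by induction on \<open>card K - card S\<close>. As \<open>S\<close> is not normal in \<open>K\<close>, its normalizer \<open>N\<close>
  in \<open>K\<close> lies in a maximal proper subgroup \<open>M\<close>. A proper subgroup \<open>L\<close> above \<open>S\<close> in which \<open>S\<close> is
  normal lies in \<open>N\<close>. In any other, some conjugate \<open>U \<noteq> S\<close> of \<open>S\<close> and \<open>S\<close> normalize each other,
  and \<open>T = \<langle>S, U\<rangle>\<close> is a strictly larger subgroup with the properties assumed of \<open>S\<close>. By induction
  there is a largest proper subgroup \<open>M'\<close> above \<open>T\<close>; both \<open>M\<close> and \<open>L\<close> are above \<open>T\<close>, so
  \<open>M = M'\<close> by maximality, and \<open>L \<subseteq> M\<close>.\<close>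

lemma largest_proper_overgroup:
  assumes fin: "finite K" and K: "subgroup K G" and S: "subgroup S G" and SK: "S \<subseteq> K"
    and sn: "\<And>L. subgroup L G \<Longrightarrow> S \<subseteq> L \<Longrightarrow> L \<subset> K \<Longrightarrow> subnormal G S L"
    and not_sn: "\<not> subnormal G S K"
  shows "\<exists>M. subgroup M G \<and> M \<subset> K \<and>
    (\<forall>L. subgroup L G \<longrightarrow> S \<subseteq> L \<longrightarrow> L \<subset> K \<longrightarrow> L \<subseteq> M)"
  using S SK sn not_sn
proof (induction S rule: measure_induct_rule[where f = "\<lambda>S. card K - card S"])
  case (less S)
  note S = less.prems(1) and SK = less.prems(2) and sn = less.prems(3) and not_sn = less.prems(4)
  have SG: "S \<subseteq> carrier G" using S by (rule subgroup.subset)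
  define N where "N = {g \<in> K. conjugate G g S = S}"
  have N: "subgroup N G"
    unfolding N_def using K SG by (rule subgroup_normalizing)
  have NK: "N \<subset> K"
  proof -
    have "N \<noteq> K"
    proof
      assume "N = K"
      then have "S \<lhd> (G\<lparr>carrier := K\<rparr>)"
        using S SK by (auto simp: normal_in_subgroup_iff[OF K] N_def)
      then show False using not_sn K subnormal_normal by blast
    qed
    then show ?thesis by (auto simp: N_def)
  qed
  define P where "P M \<longleftrightarrow> subgroup M G \<and> N \<subseteq> M \<and> M \<subset> K" for M
  have "\<exists>M. P M \<and> (\<forall>M'. P M' \<longrightarrow> card M' \<le> card M)"
    by (rule ex_has_greatest_nat[where k = N and b = "Suc (card K)"])
      (use N NK fin in \<open>auto simp: P_def less_Suc_eq_le intro!: card_mono\<close>)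
  then obtain M where M: "P M" and max: "\<And>M'. P M' \<Longrightarrow> card M' \<le> card M"
    by blast
  have "L \<subseteq> M" if L: "subgroup L G" "S \<subseteq> L" "L \<subset> K" for L
  proof (cases "S \<lhd> (G\<lparr>carrier := L\<rparr>)")
    case True
    then have "L \<subseteq> N" using L by (auto simp: normal_in_subgroup_iff N_def)
    then show ?thesis using M by (auto simp: P_def)
  next
    case False
    obtain A B where AB: "subgroup A G" "subgroup B G" "B \<subseteq> L"
      "S \<lhd> (G\<lparr>carrier := A\<rparr>)" "A \<lhd> (G\<lparr>carrier := B\<rparr>)" "\<not> S \<lhd> (G\<lparr>carrier := B\<rparr>)"
      using subnormal_not_normal[OF sn[OF L] False] .
    have A: "S \<subseteq> A" "\<And>a. a \<in> A \<Longrightarrow> conjugate G a S = S"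
      using AB by (auto simp: normal_in_subgroup_iff)
    have B: "A \<subseteq> B" "\<And>b. b \<in> B \<Longrightarrow> conjugate G b A = A"
      using AB by (auto simp: normal_in_subgroup_iff)
    obtain b where b: "b \<in> B" "conjugate G b S \<noteq> S"
      using AB A B S by (auto simp: normal_in_subgroup_iff)
    have bK: "b \<in> K" and bG: "b \<in> carrier G"
      using b(1) AB(3) L(3) subgroup.subset[OF K] by auto
    define U where "U = conjugate G b S"
    define T where "T = generate G (S \<union> U)"
    have U: "subgroup U G" unfolding U_def using bG S by (rule subgroup_conjugate)
    have UA: "U \<subseteq> A" unfolding U_def using conjugate_mono[OF A(1)] B b by blast
    have T: "subgroup T G"
      unfolding T_def using S U by (intro generate_is_subgroup) (auto dest: subgroup.subset)
    have ST: "S \<subseteq> T" and UT: "U \<subseteq> T" by (auto simp: T_def intro: generate.incl)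
    have TA: "T \<subseteq> A" unfolding T_def using A UA AB by (intro generate_subgroup_incl) auto
    have TL: "T \<subseteq> L" using TA B AB by auto
    have TN: "T \<subseteq> N" using TA TL A L by (auto simp: N_def)
    have finS: "finite S" using SK fin by (rule finite_subset)
    have "card U = card S"
      unfolding U_def conjugate_def using bG SG
      by (intro card_image inj_onI) (auto simp: subset_iff)
    then have "\<not> U \<subseteq> S"
      using card_subset_eq[OF finS, of U] b by (auto simp: U_def)
    then have "card S < card T"
      using ST UT finite_subset[OF TL] finite_subset[OF psubset_imp_subset[OF L(3)] fin]
      by (intro psubset_card_mono) auto
    moreover have "card T \<le> card K"
      using TL L fin by (intro card_mono) auto
    ultimately have measure: "card K - card T < card K - card S" by simp
    have snT: "subnormal G T L'" if L': "subgroup L' G" "T \<subseteq> L'" "L' \<subset> K" for L'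
    proof -
      have L'G: "L' \<subseteq> carrier G" using L' by (auto dest: subgroup.subset)
      \<comment> \<open>\<open>U\<close> is subnormal in \<open>L'\<close> because \<open>S\<close> is so in the conjugate of \<open>L'\<close> that carries \<open>U\<close> back
        to \<open>S\<close>.\<close>
      let ?L = "conjugate G (inv b) L'"
      have "?L \<subset> K"
      proof -
        have "?L \<subseteq> K"
          using L' K bK by (intro conjugate_subset_subgroup) (auto simp: subgroup.m_inv_closed)
        moreover have "?L \<noteq> K"
          using conjugate_inv_conjugate(2)[OF bG L'G] conjugate_self[OF K bK] L' by auto
        ultimately show ?thesis by auto
      qed
      moreover have "S \<subseteq> ?L"
        using conjugate_mono[of U L' "inv b"] conjugate_inv_conjugate(1)[OF bG SG] UT L'
        by (auto simp: U_def)
      ultimately have "subnormal G S ?L"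
        using L' bG by (intro sn) (auto intro: subgroup_conjugate)
      then have "subnormal G U L'"
        using subnormal_conjugate[of S ?L b] conjugate_inv_conjugate(2)[OF bG L'G] bG
        by (simp add: U_def)
      moreover have "subnormal G S L'" using L' ST by (intro sn) auto
      ultimately show ?thesis
        unfolding T_def using L' fin UA A
        by (intro subnormal_join) (auto intro: finite_subset)
    qed
    have "S \<lhd> (G\<lparr>carrier := T\<rparr>)"
      using S ST TA A by (auto simp: normal_in_subgroup_iff[OF T])
    then have "\<not> subnormal G T K"
      using not_sn subnormal_trans subnormal_normal T by blast
    then obtain M' where M': "subgroup M' G" "M' \<subset> K"
      "\<And>L. subgroup L G \<Longrightarrow> T \<subseteq> L \<Longrightarrow> L \<subset> K \<Longrightarrow> L \<subseteq> M'"
      using less.IH[OF measure T subset_trans[OF TL psubset_imp_subset[OF L(3)]] snT] by blast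
    have MM': "M \<subseteq> M'" using M TN by (intro M'(3)) (auto simp: P_def)
    then have "P M'" using M M' by (auto simp: P_def)
    then have "M = M'"
      using max MM' finite_subset[OF psubset_imp_subset[OF M'(2)] fin] by (intro card_seteq)
    then show ?thesis using M'(3)[of L] TL L by auto
  qed
  then show ?case using M by (auto simp: P_def)
qed

text \<open>In a smallest counterexample \<open>K\<close>, every \<open>\<langle>H, H\<^sup>g\<rangle>\<close> is proper, so the zipper lemma confines all
  conjugates of \<open>H\<close>, and with them the normal closure of \<open>H\<close>, to one proper subgroup.\<close>

theorem Wielandt_subnormal:
  assumes "finite K" "subgroup K G" "subgroup H G" "H \<subseteq> K"
    and "\<And>g. g \<in> K \<Longrightarrow> subnormal G H (generate G (H \<union> conjugate G g H))"
  shows "subnormal G H K"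
  using assms
proof (induction K rule: measure_induct_rule[where f = card])
  case (less K)
  note K = less.prems(2) and H = less.prems(3) and HK = less.prems(4) and sn = less.prems(5)
  have HG: "H \<subseteq> carrier G" using H by (rule subgroup.subset)
  have IH: "subnormal G H L" if "subgroup L G" "H \<subseteq> L" "L \<subset> K" for L
  proof (rule less.IH[OF psubset_card_mono[OF less.prems(1) that(3)] _ that(1) H that(2)])
    show "finite L" using that(3) less.prems(1) by (auto intro: finite_subset)
    show "subnormal G H (generate G (H \<union> conjugate G g H))" if "g \<in> L" for g
      using sn that \<open>L \<subset> K\<close> by blast
  qed
  show ?case
  proof (rule ccontr)
    assume not_sn: "\<not> subnormal G H K"
    obtain M where M: "subgroup M G" "M \<subset> K"
      and max: "\<And>L. subgroup L G \<Longrightarrow> H \<subseteq> L \<Longrightarrow> L \<subset> K \<Longrightarrow> L \<subseteq> M"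
      using largest_proper_overgroup[OF less.prems(1) K H HK IH not_sn] by blast
    have EM: "(\<Union>g\<in>K. conjugate G g H) \<subseteq> M"
    proof -
      have "conjugate G g H \<subseteq> M" if g: "g \<in> K" for g
      proof -
        let ?J = "generate G (H \<union> conjugate G g H)"
        have HgK: "conjugate G g H \<subseteq> K" using K g HK by (rule conjugate_subset_subgroup)
        have "?J \<subseteq> K" using K HK HgK by (intro generate_subgroup_incl) auto
        moreover have "?J \<noteq> K" using sn[OF g] not_sn by auto
        moreover have "subgroup ?J G"
          using HG HgK subgroup.subset[OF K] by (intro generate_is_subgroup) auto
        moreover have incl: "H \<union> conjugate G g H \<subseteq> ?J" by (auto intro: generate.incl)
        ultimately have "?J \<subseteq> M" by (intro max) auto
        then show ?thesis using incl by auto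
      qed
      then show ?thesis by blast
    qed
    define C where "C = normal_closure G K H"
    have "C \<subseteq> M"
      unfolding C_def normal_closure_def using EM M(1) by (rule generate_subgroup_incl)
    then have "subnormal G H C"
      unfolding C_def using M K HK
      by (intro IH subgroup_normal_closure subset_normal_closure) auto
    moreover have "C \<lhd> (G\<lparr>carrier := K\<rparr>)"
      unfolding C_def using K HK by (rule normal_closure_normal)
    ultimately show False using not_sn K subnormal.step by blast
  qed
qed

text \<open>The hypothesis concerns single elements \<open>g\<close> and therefore passes to subgroups above \<open>H\<close>. This
  allows an induction in which only the case \<open>\<langle>H, H\<^sup>g\<rangle> = K\<close> is left, and there \<open>g \<in> K\<close> normalizes
  \<open>H\<close>, so that \<open>K = H\<close>.\<close>

theorem subnormal_if_conjugators_in_join_normalize: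
  assumes "finite K" "subgroup K G" "subgroup H G" "H \<subseteq> K"
    and "\<And>g. g \<in> K \<Longrightarrow> g \<in> generate G (H \<union> conjugate G g H) \<Longrightarrow> conjugate G g H = H"
  shows "subnormal G H K"
  using assms
proof (induction K rule: measure_induct_rule[where f = card])
  case (less K)
  note K = less.prems(2) and H = less.prems(3) and HK = less.prems(4)
  show ?case
  proof (rule Wielandt_subnormal[OF less.prems(1-4)])
    fix g assume g: "g \<in> K"
    let ?J = "generate G (H \<union> conjugate G g H)"
    have sub: "H \<union> conjugate G g H \<subseteq> K"
      using HK conjugate_subset_subgroup[OF K g HK] by auto
    then have JK: "?J \<subseteq> K" using K by (intro generate_subgroup_incl)
    have J: "subgroup ?J G"
      using sub subgroup.subset[OF K] by (intro generate_is_subgroup) auto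
    have HJ: "H \<subseteq> ?J" by (auto intro: generate.incl)
    show "subnormal G H ?J"
    proof (cases "?J = K")
      case True
      then have "conjugate G g H = H" using less.prems(5) g by simp
      then show ?thesis using generateI[OF H] H by (simp add: subnormal.self)
    next
      case False
      then have "?J \<subset> K" using JK by auto
      then have "card ?J < card K" using less.prems(1) by (intro psubset_card_mono)
      then show ?thesis
      proof (rule less.IH[OF _ _ J H HJ])
        show "finite ?J" using JK less.prems(1) by (rule finite_subset)
      qed (use less.prems(5) JK in blast)
    qed
  qed
qed

end

section \<open>Special triples\<close>

lemma (in special_triple) card_eq_one: "card X = 1"
proof -
  interpret group G
    using group_hom group_hom.axioms(1) by auto
  have St: "subgroup (stabilizer G \<phi> x) G"
    using base_point by (rule stabilizer_subgroup)
  have H: "subgroup H G" and HSt: "H \<subseteq> stabilizer G \<phi> x"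
    using normal_H normal_in_subgroup_iff[OF St] by auto
  have HG: "H \<subseteq> carrier G" using H by (rule subgroup.subset)
  have at: "subgroup_at (\<phi> g x) = conjugate G g H" if "g \<in> carrier G" for g
    using subgroup_at_eq[OF that refl] by (simp add: conjugate_eq_cosets)
  have "\<phi> \<one> x = x" using fun_cong[OF id_eq_one, of x] base_point by simp
  then have at_x: "subgroup_at x = H" using at[of \<one>] conjugate_one[OF HG] by simp
  have at_G: "subgroup_at y \<subseteq> carrier G" if y: "y \<in> X" for y
  proof -
    obtain g where g: "g \<in> carrier G" "\<phi> g x = y"
      using unique_orbit[OF base_point y] by blast
    then show ?thesis using at[OF g(1)] conjugate_subset_carrier[OF g(1) HG] by simp
  qed
  define N where "N = span X"
  have N: "subgroup N G"
    unfolding N_def span_def using at_G by (intro generate_is_subgroup) auto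
  have HN: "H \<subseteq> N"
    unfolding N_def span_def using base_point at_x by (auto intro: generate.incl)
  have trans: "\<exists>n\<in>N. \<phi> n x = y" if "y \<in> X" for y
    using transitive_action.unique_orbit[OF span_transitive base_point that] by (simp add: N_def)
  have "subnormal G H N"
  proof (rule subnormal_if_conjugators_in_join_normalize[OF _ N H HN])
    show "finite N" using finite_G subgroup.subset[OF N] by (rule rev_finite_subset)
    fix g assume g: "g \<in> N" and gJ: "g \<in> generate G (H \<union> conjugate G g H)"
    have gG: "g \<in> carrier G" using g N by (simp add: subgroup.mem_carrier)
    let ?y = "\<phi> g x"
    have y: "?y \<in> X" using gG base_point by (simp add: element_image)
    have "span {x, ?y} = generate G (H \<union> conjugate G g H)"
      by (simp add: span_def at_x at[OF gG])
    then have "?y \<in> orbit (span_group {x, ?y}) \<phi> x"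
      using gJ by (auto simp: orbit_def)
    then have "?y = x" using separated[OF base_point y] by metis
    then show "conjugate G g H = H" using at[OF gG] at_x by simp
  qed
  have "H = N"
  proof (rule ccontr)
    assume "H \<noteq> N"
    then have proper: "normal_closure G N H \<subset> N"
      using \<open>subnormal G H N\<close> by (intro subnormal_imp_normal_closure_proper)
    have "subgroup_at y \<subseteq> normal_closure G N H" if y: "y \<in> X" for y
    proof -
      obtain n where n: "n \<in> N" "\<phi> n x = y" using trans[OF y] by blast
      then have "subgroup_at y = conjugate G n H" using at[of n] subgroup.mem_carrier[OF N] by simp
      then show ?thesis unfolding normal_closure_def using n by (auto intro: generate.incl)
    qed
    then have "N \<subseteq> normal_closure G N H"
      using generate_subgroup_incl[OF _ subgroup_normal_closure[OF N HN]]
      by (simp add: N_def span_def UN_subset_iff)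
    then show False using proper by auto
  qed
  have "y = x" if "y \<in> X" for y
    using trans[OF that] HSt \<open>H = N\<close> by (auto simp: stabilizer_def)
  then have "X = {x}" using base_point by blast
  then show ?thesis by simp
qed

theorem theorem2p4:
  fixes G :: "('g, 'm) monoid_scheme"
    and X :: "'x set"
    and \<phi> :: "'g \<Rightarrow> 'x \<Rightarrow> 'x"
    and H :: "'g set"
    and x :: 'x
  assumes "special_triple G X \<phi> H x"
  shows "card X = 1"
  using assms by (rule special_triple.card_eq_one)

end
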